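(* Let $n\ge 1$ and let $A,B,C,D$ be normal $n\times n$ complex matrices. Then $$\left\|\begin{pmatrix} A & B\\ C & D\end{pmatrix}\right\|_{\infty}\le \max\left\{\,\big\|\,|A|+|B|\,\big\|_{\infty},\ \big\|\,|C|+|D|\,\big\|_{\infty},\ \big\|\,|A|+|C|\,\big\|_{\infty},\ \big\|\,|B|+|D|\,\big\|_{\infty}\right\}.$$
   Context: $\|\cdot\|_\infty$ denotes the operator norm (largest singular value). For a matrix $Y$, $|Y|=(Y^*Y)^{1/2}$. *)

theory Defs
  imports "HOL-Analysis.Analysis"
begin

definition conj_transpose :: "complex^'n^'m \<Rightarrow> complex^'m^'n" where
  "conj_transpose A = (\<chi> i j. cnj (A $ j $ i))"

definition normal_matrix :: "complex^'n^'n \<Rightarrow> bool" where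
  "normal_matrix A \<longleftrightarrow> A ** conj_transpose A = conj_transpose A ** A"

definition psd_matrix :: "complex^'n^'n \<Rightarrow> bool" where
  "psd_matrix P \<longleftrightarrow> conj_transpose P = P \<and>
     (\<forall>x. 0 \<le> Re (\<Sum>i\<in>UNIV. cnj (x $ i) * (P *v x) $ i))"

text \<open>The square root of a positive semidefinite matrix \<open>M\<close> is its unique positive
  semidefinite square root; for other \<open>M\<close> the value is unspecified.\<close>

definition matrix_sqrt :: "complex^'n^'n \<Rightarrow> complex^'n^'n" where
  "matrix_sqrt M = (THE P. psd_matrix P \<and> P ** P = M)"

definition matrix_abs :: "complex^'n^'n \<Rightarrow> complex^'n^'n" where
  "matrix_abs Y = matrix_sqrt (conj_transpose Y ** Y)"

text \<open>The operator norm induced by the Euclidean norms, that is, the largest singular value.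
  The library's \<open>norm\<close> on a matrix type is the Frobenius norm, hence the use of \<open>onorm\<close>.\<close>

definition op_norm :: "complex^'n^'m \<Rightarrow> real" where
  "op_norm A = onorm (\<lambda>x. A *v x)"

text \<open>Rows and columns with index \<open>Inl i\<close> form the first block, those with index
  \<open>Inr i\<close> the second.\<close>

definition block_matrix ::
  "complex^'n^'n \<Rightarrow> complex^'n^'n \<Rightarrow> complex^'n^'n \<Rightarrow> complex^'n^'n \<Rightarrow> complex^('n + 'n)^('n + 'n)" where
  "block_matrix A B C D = (\<chi> i j.
     case i of
       Inl i' \<Rightarrow> (case j of Inl j' \<Rightarrow> A $ i' $ j' | Inr j' \<Rightarrow> B $ i' $ j')
     | Inr i' \<Rightarrow> (case j of Inl j' \<Rightarrow> C $ i' $ j' | Inr j' \<Rightarrow> D $ i' $ j'))"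

end

theory Submission
  imports Defs "HOL-Computational_Algebra.Fundamental_Theorem_Algebra"
begin

text \<open>For a normal matrix \<open>X\<close> with orthonormal eigenvectors \<open>u\<close> and eigenvalues \<open>l u\<close>, the matrix \<open>|X|\<close>
  has the same eigenvectors with eigenvalues \<open>|l u|\<close>. Splitting each \<open>|l u|\<close> into two square roots, the
  Cauchy--Schwarz inequality for the sum over the eigenvectors gives
  \<open>|\<langle>x, X y\<rangle>| \<le> sqrt \<langle>x, |X| x\<rangle> * sqrt \<langle>y, |X| y\<rangle>\<close> (lemma \<open>cmod_cinner_le_abs_form\<close>). Normality is what allows
  the same matrix \<open>|X|\<close> on both sides; in general the first factor would involve \<open>|X\<^sup>*|\<close>.

  Write \<open>x = (x\<^sub>1, x\<^sub>2)\<close>, \<open>y = (y\<^sub>1, y\<^sub>2)\<close> and let \<open>M\<close> be the block matrix. Then \<open>\<langle>x, M y\<rangle>\<close> is a sum of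
  four terms, one for each block, and a second application of Cauchy--Schwarz, to these four terms,
  bounds \<open>|\<langle>x, M y\<rangle>|\<^sup>2\<close> by the product of
  \<open>\<langle>x\<^sub>1, (|A| + |B|) x\<^sub>1\<rangle> + \<langle>x\<^sub>2, (|C| + |D|) x\<^sub>2\<rangle>\<close> and
  \<open>\<langle>y\<^sub>1, (|A| + |C|) y\<^sub>1\<rangle> + \<langle>y\<^sub>2, (|B| + |D|) y\<^sub>2\<rangle>\<close>. So the row sums of absolute values control the
  \<open>x\<close>-factor, the column sums the \<open>y\<close>-factor, and if \<open>K\<close> is the largest of the four norms, the product
  is at most \<open>(K * (norm x)\<^sup>2) * (K * (norm y)\<^sup>2)\<close>.

  The ingredients are the spectral theorem (\<open>normal_matrix_orthonormal_eigenbasis\<close>) and the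
  identification of \<open>|X|\<close> on the eigenvectors (\<open>matrix_abs_eigenvector\<close>), which includes the existence
  and the uniqueness of the positive semidefinite square root of \<open>X\<^sup>* X\<close>.\<close>

section \<open>The Hermitian inner product\<close>

definition cinner :: "complex^'n \<Rightarrow> complex^'n \<Rightarrow> complex" where
  "cinner x y = (\<Sum>i\<in>UNIV. cnj (x $ i) * y $ i)"

lemma cinner_add_left: "cinner (x + y) z = cinner x z + cinner y z"
  and cinner_add_right: "cinner z (x + y) = cinner z x + cinner z y"
  and cinner_diff_left: "cinner (x - y) z = cinner x z - cinner y z"
  and cinner_diff_right: "cinner z (x - y) = cinner z x - cinner z y"
  and cinner_scale_left: "cinner (c *s x) z = cnj c * cinner x z"
  and cinner_scale_right: "cinner z (c *s x) = c * cinner z x"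
  by (simp_all add: cinner_def algebra_simps sum.distrib sum_subtractf sum_distrib_left)

lemma cinner_zero_left: "cinner 0 x = 0"
  and cinner_zero_right: "cinner x 0 = 0"
  by (simp_all add: cinner_def)

lemmas cinner_simps = cinner_add_left cinner_add_right cinner_diff_left cinner_diff_right
  cinner_scale_left cinner_scale_right cinner_zero_left cinner_zero_right

lemma cinner_sum_right: "cinner x (\<Sum>u\<in>S. f u) = (\<Sum>u\<in>S. cinner x (f u))"
  by (induction S rule: infinite_finite_induct) (auto simp: cinner_simps)

lemma cinner_commute: "cinner y x = cnj (cinner x y)"
  by (simp add: cinner_def mult.commute)

lemma Re_cinner: "Re (cinner x y) = x \<bullet> y"
  by (simp add: cinner_def inner_vec_def inner_complex_def)

lemma cinner_self: "cinner x x = of_real ((norm x)\<^sup>2)"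
proof (rule complex_eqI)
  show "Im (cinner x x) = Im (of_real ((norm x)\<^sup>2))"
    by (simp add: cinner_def mult.commute flip: of_real_power)
qed (simp add: Re_cinner power2_norm_eq_inner flip: of_real_power)

lemma cinner_self_eq_0_iff: "cinner x x = 0 \<longleftrightarrow> x = 0"
  by (simp add: cinner_self)

lemma cinner_matrix_right: "cinner x (A *v y) = cinner (conj_transpose A *v x) y"
proof -
  have "cinner x (A *v y) = (\<Sum>i\<in>UNIV. \<Sum>j\<in>UNIV. cnj (x $ i) * A $ i $ j * y $ j)"
    by (simp add: cinner_def matrix_vector_mult_def sum_distrib_left mult.assoc)
  also have "\<dots> = (\<Sum>j\<in>UNIV. \<Sum>i\<in>UNIV. cnj (x $ i) * A $ i $ j * y $ j)"
    by (rule sum.swap)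
  also have "\<dots> = cinner (conj_transpose A *v x) y"
    by (simp add: cinner_def matrix_vector_mult_def conj_transpose_def sum_distrib_right sum_distrib_left
        mult_ac)
  finally show ?thesis .
qed

lemma conj_transpose_conj_transpose: "conj_transpose (conj_transpose A) = A"
  by (simp add: conj_transpose_def vec_eq_iff)

lemmas matrix_scale_mult = vec.linear_scale[OF matrix_vector_mul_linear_gen]
lemmas matrix_mult_sum_right = vec.linear_sum[OF matrix_vector_mul_linear_gen]

lemma psd_matrix_iff_cinner:
  "psd_matrix P \<longleftrightarrow> conj_transpose P = P \<and> (\<forall>x. 0 \<le> Re (cinner x (P *v x)))"
  by (simp add: psd_matrix_def cinner_def)

text \<open>Normality of \<open>A\<close> says that \<open>A - l I\<close> and its adjoint have equal norm at every vector, so their kernels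
  coincide. The computation expands the square of \<open>norm (A\<^sup>* u - cnj l *s u)\<close> and finds that its terms
  cancel.\<close>

lemma normal_eigenvector_adjoint:
  assumes "normal_matrix A" and eig: "A *v u = l *s u"
  shows "conj_transpose A *v u = cnj l *s u"
proof -
  let ?B = "conj_transpose A"
  have "cinner (?B *v u) (?B *v u) = cinner u (A *v (?B *v u))"
    by (simp add: cinner_matrix_right)
  also have "\<dots> = cinner u (?B *v (A *v u))"
    using assms(1) by (simp add: normal_matrix_def matrix_vector_mul_assoc)
  also have "\<dots> = cinner (A *v u) (A *v u)"
    by (simp add: cinner_matrix_right[of u] conj_transpose_conj_transpose)
  finally have 1: "cinner (?B *v u) (?B *v u) = cnj l * l * cinner u u"
    by (simp add: eig cinner_simps)
  have 2: "cinner (?B *v u) u = l * cinner u u"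
    by (simp add: eig cinner_simps flip: cinner_matrix_right)
  then have 3: "cinner u (?B *v u) = cnj l * cinner u u"
    by (metis cinner_commute complex_cnj_mult)
  have "cinner (?B *v u - cnj l *s u) (?B *v u - cnj l *s u) = 0"
    by (simp add: cinner_simps 1 2 3)
  then show ?thesis
    by (simp add: cinner_self_eq_0_iff)
qed

section \<open>Eigenvectors in invariant subspaces\<close>

text \<open>The vector \<open>p(A) v\<close>, evaluated by Horner's rule.\<close>

definition poly_apply :: "complex^'n^'n \<Rightarrow> complex poly \<Rightarrow> complex^'n \<Rightarrow> complex^'n" where
  "poly_apply A p v = fold_coeffs (\<lambda>c w. c *s v + A *v w) p 0"

lemma poly_apply_0 [simp]: "poly_apply A 0 v = 0"
  by (simp add: poly_apply_def)

lemma poly_apply_pCons [simp]: "poly_apply A (pCons c p) v = c *s v + A *v poly_apply A p v"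
  by (cases "p = 0 \<and> c = 0") (auto simp: poly_apply_def)

lemma poly_apply_add: "poly_apply A (p + q) v = poly_apply A p v + poly_apply A q v"
  by (induction p q rule: poly_induct2)
    (simp_all add: matrix_vector_right_distrib vec.scale_left_distrib algebra_simps)

lemma poly_apply_smult: "poly_apply A (smult c p) v = c *s poly_apply A p v"
  by (induction p) (simp_all add: matrix_scale_mult vec.scale_right_distrib)

lemma poly_apply_sum: "poly_apply A (\<Sum>i\<in>I. f i) v = (\<Sum>i\<in>I. poly_apply A (f i) v)"
  by (induction I rule: infinite_finite_induct) (simp_all add: poly_apply_add)

lemma poly_apply_monom: "poly_apply A (monom c i) v = c *s (((*v) A ^^ i) v)"
  by (induction i) (simp_all add: monom_0 monom_Suc matrix_scale_mult)

lemma poly_apply_linear_factor: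
  "poly_apply A ([:- l, 1:] * q) v = poly_apply A q (A *v v - l *s v)"
proof (induction q)
  case (pCons a q)
  have "[:- l, 1:] * pCons a q = smult a [:- l, 1:] + pCons 0 ([:- l, 1:] * q)"
    by (simp add: mult.commute[of _ "pCons a q"] mult.commute[of q] del: mult_pCons_left)
  then show ?case
    using pCons
    by (simp only: poly_apply_add poly_apply_smult poly_apply_pCons)
      (simp add: matrix_scale_mult vec.scale_right_distrib vec.scale_right_diff_distrib)
qed simp

text \<open>The vectors \<open>v, A v, \<dots>, A\<^sup>n v\<close> are one more than the dimension, so they satisfy a nontrivial linear
  relation, and its coefficients are those of \<open>p\<close>. Linear dependence is a property of sets, which
  is why a repetition among these vectors needs separate treatment.\<close>

lemma annihilating_poly_exists: "\<exists>p. p \<noteq> 0 \<and> poly_apply A p v = 0"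
  for A :: "complex^'n^'n"
proof -
  let ?f = "\<lambda>i. ((*v) A ^^ i) v"
  define N where "N = CARD('n)"
  show ?thesis
  proof (cases "inj_on ?f {..N}")
    case False
    then obtain i j where ij: "i \<noteq> j" "?f i = ?f j"
      by (auto simp: inj_on_def)
    let ?p = "monom 1 i + monom (-1) j :: complex poly"
    have "coeff ?p i \<noteq> 0" using ij by simp
    then have "?p \<noteq> 0" by (metis coeff_0)
    moreover have "poly_apply A ?p v = 0"
      using ij by (simp add: poly_apply_add poly_apply_monom)
    ultimately show ?thesis by blast
  next
    case True
    have "vec.dependent (?f ` {..N})"
    proof (rule ccontr)
      assume "\<not> ?thesis"
      then have "card (?f ` {..N}) \<le> CARD('n)"
        using vec.independent_card_le_dim[of "?f ` {..N}" UNIV] by (simp only: vec_dim_card) simp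
      then show False using card_image[OF True] by (simp add: N_def)
    qed
    then obtain c where c: "\<exists>x\<in>?f ` {..N}. c x \<noteq> 0" "(\<Sum>x\<in>?f ` {..N}. c x *s x) = 0"
      using vec.dependent_finite[of "?f ` {..N}"] by auto
    define p where "p = (\<Sum>i\<le>N. monom (c (?f i)) i)"
    obtain k where k: "k \<le> N" "c (?f k) \<noteq> 0" using c by auto
    have "coeff p k = c (?f k)"
      using k by (simp add: p_def coeff_sum)
    then have "p \<noteq> 0" using k by auto
    moreover have "poly_apply A p v = 0"
      using c(2) by (simp add: p_def poly_apply_sum poly_apply_monom sum.reindex[OF True])
    ultimately show ?thesis by blast
  qed
qed

text \<open>Let \<open>l\<close> be a root of \<open>p\<close>. Either \<open>v\<close> is an eigenvector for \<open>l\<close>, or \<open>A v - l v\<close> is a nonzero vector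
  that is annihilated by the quotient of \<open>p\<close> by the linear factor of \<open>l\<close>, which has smaller degree. The
  search never leaves \<open>W\<close>, so the eigenvector is found in \<open>W\<close>.\<close>

lemma eigenvector_of_annihilating_poly:
  fixes A :: "complex^'n^'n"
  assumes "p \<noteq> 0" "poly_apply A p v = 0" "v \<noteq> 0" "v \<in> W"
    and W: "\<And>x l. x \<in> W \<Longrightarrow> A *v x - l *s x \<in> W"
  shows "\<exists>w l. w \<in> W \<and> w \<noteq> 0 \<and> A *v w = l *s w"
  using assms(1-4)
proof (induction "degree p" arbitrary: p v)
  case 0
  then obtain c where "p = [:c:]" by (metis degree_eq_zeroE)
  with 0 show ?case by simp
next
  case (Suc n)
  then have "\<not> constant (poly p)" by (simp add: constant_degree)
  then obtain l where "poly p l = 0" using fundamental_theorem_of_algebra by blast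
  then obtain q where q: "p = [:- l, 1:] * q" by (auto simp: poly_eq_0_iff_dvd)
  show ?case
  proof (cases "A *v v = l *s v")
    case True
    then show ?thesis using Suc.prems by blast
  next
    case False
    have "q \<noteq> 0" using Suc.prems q by auto
    moreover from this have "degree p = Suc (degree q)" unfolding q by (subst degree_mult_eq) auto
    ultimately show ?thesis
      using Suc.hyps(1)[of q "A *v v - l *s v"] Suc.hyps(2) Suc.prems False W[of v l] q
      by (simp only: poly_apply_linear_factor) auto
  qed
qed

section \<open>The spectral theorem for normal matrices\<close>

definition orthonormal :: "(complex^'n) set \<Rightarrow> bool" where
  "orthonormal S \<longleftrightarrow> (\<forall>u\<in>S. \<forall>v\<in>S. cinner u v = (if u = v then 1 else 0))"

lemma orthonormal_finite_card:
  fixes S :: "(complex^'n) set"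
  assumes "orthonormal S"
  shows "finite S \<and> card S \<le> DIM(complex^'n)"
proof -
  have "pairwise orthogonal S"
    using assms unfolding orthonormal_def pairwise_def orthogonal_def
    by (metis Re_cinner zero_complex.sel(1))
  moreover have "0 \<notin> S"
    using assms by (force simp: orthonormal_def cinner_simps)
  ultimately show ?thesis
    by (intro independent_bound pairwise_orthogonal_independent)
qed

lemma orthonormal_coefficient:
  assumes "orthonormal S" "u \<in> S"
  shows "cinner u (\<Sum>v\<in>S. c v *s v) = c u"
proof -
  have "cinner u (\<Sum>v\<in>S. c v *s v) = (\<Sum>v\<in>S. if v = u then c v else 0)"
    using assms by (auto simp: cinner_sum_right cinner_simps orthonormal_def intro!: sum.cong)
  then show ?thesis
    using assms orthonormal_finite_card[of S] by simp
qed

text \<open>The elements of \<open>S\<close> are also eigenvectors of the adjoint, so \<open>\<langle>u, A x\<rangle> = \<langle>A\<^sup>* u, x\<rangle>\<close> is a multiple of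
  \<open>\<langle>u, x\<rangle>\<close>.\<close>

lemma normal_orthogonal_complement_invariant:
  assumes "normal_matrix A" "\<And>u. u \<in> S \<Longrightarrow> \<exists>l. A *v u = l *s u"
    and "\<forall>u\<in>S. cinner u x = 0"
  shows "\<forall>u\<in>S. cinner u (A *v x - l *s x) = 0"
proof
  fix u assume "u \<in> S"
  then obtain k where "A *v u = k *s u" using assms(2) by blast
  then have "conj_transpose A *v u = cnj k *s u"
    using assms(1) by (simp add: normal_eigenvector_adjoint)
  then show "cinner u (A *v x - l *s x) = 0"
    using assms(3) \<open>u \<in> S\<close> by (simp add: cinner_simps cinner_matrix_right)
qed

text \<open>Take an orthonormal set \<open>S\<close> of eigenvectors of largest cardinality. Its orthogonal complement is
  invariant; if it were nonzero it would contain an eigenvector, which after normalisation could be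
  added to \<open>S\<close>. Hence the complement is zero, and \<open>x\<close> minus its orthogonal projection onto the span of
  \<open>S\<close> lies in it.\<close>

theorem normal_matrix_orthonormal_eigenbasis:
  fixes A :: "complex^'n^'n"
  assumes "normal_matrix A"
  obtains S l where "orthonormal S" "\<And>u. u \<in> S \<Longrightarrow> A *v u = l u *s u"
    "\<And>x. x = (\<Sum>u\<in>S. cinner u x *s u)"
proof -
  let ?P = "\<lambda>S. orthonormal S \<and> (\<forall>u\<in>S. \<exists>l. A *v u = l *s u)"
  have "?P {}" by (simp add: orthonormal_def)
  then have "\<exists>S. ?P S \<and> (\<forall>T. ?P T \<longrightarrow> card T \<le> card S)"
    by (rule ex_has_greatest_nat[where b = "Suc DIM(complex^'n)"])
      (use orthonormal_finite_card less_Suc_eq_le in blast)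
  then obtain S where S: "?P S" and max: "\<And>T. ?P T \<Longrightarrow> card T \<le> card S"
    by blast
  have fin: "finite S" using S orthonormal_finite_card by blast
  let ?W = "{x. \<forall>u\<in>S. cinner u x = 0}"
  have trivial: "x = 0" if x: "x \<in> ?W" for x
  proof (rule ccontr)
    assume "x \<noteq> 0"
    obtain p where "p \<noteq> 0" "poly_apply A p x = 0" using annihilating_poly_exists by blast
    moreover have "A *v y - l *s y \<in> ?W" if "y \<in> ?W" for y l
      using normal_orthogonal_complement_invariant[OF assms, of S y l] S that by blast
    ultimately obtain w l where w: "w \<in> ?W" "w \<noteq> 0" "A *v w = l *s w"
      using eigenvector_of_annihilating_poly[of p A x ?W] \<open>x \<noteq> 0\<close> x by blast
    define e where "e = of_real (1 / norm w) *s w"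
    have e: "cinner e e = 1"
      unfolding e_def cinner_scale_left cinner_scale_right cinner_self[of w]
      using w by (simp add: power2_eq_square)
    have eS: "\<forall>u\<in>S. cinner u e = 0" using w by (simp add: e_def cinner_simps)
    then have "\<forall>u\<in>S. cinner e u = 0" by (subst cinner_commute) simp
    moreover have "e \<notin> S" using e eS by auto
    ultimately have "orthonormal (insert e S)"
      using S e eS by (auto simp: orthonormal_def)
    moreover have "A *v e = l *s e"
      using w by (simp add: e_def matrix_scale_mult mult.commute)
    ultimately have "card (insert e S) \<le> card S" using S max[of "insert e S"] by blast
    then show False using fin \<open>e \<notin> S\<close> by simp
  qed
  have expand: "x = (\<Sum>u\<in>S. cinner u x *s u)" for x
  proof -
    have "x - (\<Sum>u\<in>S. cinner u x *s u) \<in> ?W"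
      using S by (simp add: cinner_simps orthonormal_coefficient)
    then have "x - (\<Sum>u\<in>S. cinner u x *s u) = 0" by (rule trivial)
    then show ?thesis by simp
  qed
  obtain l where "\<And>u. u \<in> S \<Longrightarrow> A *v u = l u *s u" using S by metis
  then show thesis using that expand S by blast
qed

section \<open>The absolute value of a normal matrix\<close>

text \<open>This is what makes the positive semidefinite square root unique. The vector \<open>w = P u - r u\<close> satisfies
  \<open>P w = - r w\<close>, because \<open>(P + r)(P - r) u = 0\<close>. For \<open>r > 0\<close> positivity of \<open>P\<close> forces \<open>w = 0\<close>; for
  \<open>r = 0\<close> the square of \<open>norm (P u)\<close> is \<open>\<langle>u, P (P u)\<rangle> = 0\<close>.\<close>

lemma psd_square_root_eigenvector:
  assumes P: "psd_matrix P" and sq: "P *v (P *v u) = of_real (r\<^sup>2) *s u" and "r \<ge> 0"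
  shows "P *v u = of_real r *s u"
proof -
  have herm: "cinner x (P *v y) = cinner (P *v x) y" for x y
    using P by (simp add: psd_matrix_iff_cinner cinner_matrix_right)
  show ?thesis
  proof (cases "r = 0")
    case True
    then have "cinner (P *v u) (P *v u) = 0"
      using sq by (simp add: cinner_simps flip: herm)
    then show ?thesis using True by (simp add: cinner_self_eq_0_iff)
  next
    case False
    define w where "w = P *v u - of_real r *s u"
    have "P *v w = - (of_real r *s w)"
      by (simp add: w_def matrix_vector_mult_diff_distrib matrix_scale_mult sq
          vec.scale_right_diff_distrib power2_eq_square)
    then have "cinner w (P *v w) = - of_real (r * (norm w)\<^sup>2)"
      by (metis cinner_diff_right cinner_zero_right cinner_scale_right cinner_self diff_0 of_real_mult)
    moreover have "0 \<le> Re (cinner w (P *v w))"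
      using P by (simp add: psd_matrix_iff_cinner)
    ultimately have "r * (norm w)\<^sup>2 \<le> 0" by simp
    then have "w = 0"
      using False \<open>r \<ge> 0\<close> by (simp add: mult_le_0_iff)
    then show ?thesis by (simp add: w_def)
  qed
qed

lemma matrix_eq_on_spanning_set:
  fixes P Q :: "complex^'n^'n"
  assumes "\<And>x. x = (\<Sum>u\<in>S. cinner u x *s u)" "\<And>u. u \<in> S \<Longrightarrow> P *v u = Q *v u"
  shows "P = Q"
proof -
  have "P *v x = Q *v x" for x
  proof -
    have "P *v (\<Sum>u\<in>S. cinner u x *s u) = Q *v (\<Sum>u\<in>S. cinner u x *s u)"
      using assms(2) by (simp add: matrix_mult_sum_right matrix_scale_mult)
    then show ?thesis by (metis assms(1))
  qed
  then show ?thesis by (simp add: matrix_eq)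
qed

lemma matrix_with_eigenvalues_exists:
  fixes S :: "(complex^'n) set" and r :: "complex^'n \<Rightarrow> real"
  assumes "orthonormal S"
  obtains P :: "complex^'n^'n" where "\<And>u. u \<in> S \<Longrightarrow> P *v u = of_real (r u) *s u"
    "conj_transpose P = P"
proof -
  \<comment> \<open>the sum of the rank-one matrices \<open>r u \<cdot> u u\<^sup>*\<close>\<close>
  define P :: "complex^'n^'n" where
    "P = (\<chi> i j. \<Sum>u\<in>S. of_real (r u) * (u $ i * cnj (u $ j)))"
  have "P *v x = (\<Sum>u\<in>S. (of_real (r u) * cinner u x) *s u)" for x
  proof (rule vec_eq_iff[THEN iffD2], rule allI)
    fix i
    have "(P *v x) $ i = (\<Sum>j\<in>UNIV. \<Sum>u\<in>S. of_real (r u) * (u $ i * cnj (u $ j)) * x $ j)"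
      by (simp add: P_def matrix_vector_mult_def sum_distrib_right)
    also have "\<dots> = (\<Sum>u\<in>S. \<Sum>j\<in>UNIV. of_real (r u) * (u $ i * cnj (u $ j)) * x $ j)"
      by (rule sum.swap)
    also have "\<dots> = (\<Sum>u\<in>S. (of_real (r u) * cinner u x) *s u) $ i"
      by (simp add: cinner_def sum_distrib_left sum_distrib_right mult_ac)
    finally show "(P *v x) $ i = (\<Sum>u\<in>S. (of_real (r u) * cinner u x) *s u) $ i" .
  qed
  moreover have "(\<Sum>v\<in>S. (of_real (r v) * cinner v u) *s v) = of_real (r u) *s u" if "u \<in> S" for u
  proof -
    have "(\<Sum>v\<in>S. (of_real (r v) * cinner v u) *s v) = (\<Sum>v\<in>S. if v = u then of_real (r v) *s v else 0)"
      using assms that by (auto simp: orthonormal_def intro!: sum.cong)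
    then show ?thesis
      using that orthonormal_finite_card[OF assms] by simp
  qed
  moreover have "conj_transpose P = P"
    by (simp add: P_def conj_transpose_def vec_eq_iff mult_ac)
  ultimately show thesis using that[of P] by simp
qed

lemma cinner_eigenbasis:
  assumes "\<And>u. u \<in> S \<Longrightarrow> A *v u = l u *s u" "\<And>x. x = (\<Sum>u\<in>S. cinner u x *s u)"
  shows "cinner x (A *v y) = (\<Sum>u\<in>S. l u * (cnj (cinner u x) * cinner u y))"
proof -
  have "cinner x (A *v (\<Sum>u\<in>S. cinner u y *s u)) = (\<Sum>u\<in>S. l u * (cinner x u * cinner u y))"
    using assms(1)
    by (simp add: matrix_mult_sum_right matrix_scale_mult cinner_sum_right cinner_simps mult_ac)
  moreover have "cinner x u = cnj (cinner u x)" for u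
    by (rule cinner_commute)
  ultimately show ?thesis by (metis (no_types, lifting) assms(2) sum.cong)
qed

lemma Re_cinner_eigenbasis:
  assumes "\<And>u. u \<in> S \<Longrightarrow> A *v u = of_real (r u) *s u" "\<And>x. x = (\<Sum>u\<in>S. cinner u x *s u)"
  shows "Re (cinner x (A *v x)) = (\<Sum>u\<in>S. r u * (cmod (cinner u x))\<^sup>2)"
proof -
  have "cinner x (A *v x) = (\<Sum>u\<in>S. of_real (r u) * (cnj (cinner u x) * cinner u x))"
    by (rule cinner_eigenbasis) (use assms in auto)
  also have "\<dots> = of_real (\<Sum>u\<in>S. r u * (cmod (cinner u x))\<^sup>2)"
    by (simp only: of_real_sum of_real_mult complex_norm_square mult.commute[of "cnj _"])
  finally show ?thesis by simp
qed

text \<open>The self-adjoint matrix \<open>P\<close> with eigenvectors \<open>u\<close> and eigenvalues \<open>|l u|\<close> is positive semidefinite and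
  squares to \<open>A\<^sup>* A\<close>. Any other such root acts on each \<open>u\<close> as \<open>P\<close> does, so the definite description in
  the definition of \<open>matrix_sqrt\<close> picks out \<open>P\<close>.\<close>

lemma matrix_abs_eigenvector:
  fixes A :: "complex^'n^'n"
  assumes "normal_matrix A" "orthonormal S" and eig: "\<And>u. u \<in> S \<Longrightarrow> A *v u = l u *s u"
    and expand: "\<And>x. x = (\<Sum>u\<in>S. cinner u x *s u)"
    and "u \<in> S"
  shows "matrix_abs A *v u = of_real (cmod (l u)) *s u"
proof -
  let ?M = "conj_transpose A ** A"
  have M: "?M *v u = of_real ((cmod (l u))\<^sup>2) *s u" if "u \<in> S" for u
    using normal_eigenvector_adjoint[OF assms(1) eig[OF that]] eig[OF that]
    by (simp add: matrix_scale_mult complex_norm_square mult.commute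
        flip: matrix_vector_mul_assoc of_real_power)
  obtain P :: "complex^'n^'n" where P: "\<And>u. u \<in> S \<Longrightarrow> P *v u = of_real (cmod (l u)) *s u"
    "conj_transpose P = P"
    using matrix_with_eigenvalues_exists[OF assms(2), of "\<lambda>u. cmod (l u)"] by metis
  have "0 \<le> Re (cinner x (P *v x))" for x
    by (subst Re_cinner_eigenbasis[OF P(1) expand]) (auto intro: sum_nonneg)
  then have "psd_matrix P" using P by (simp add: psd_matrix_iff_cinner)
  moreover have "P ** P = ?M"
    by (rule matrix_eq_on_spanning_set[OF expand])
      (simp add: M P matrix_scale_mult power2_eq_square flip: matrix_vector_mul_assoc[of P P])
  moreover have "Q = P" if Q: "psd_matrix Q \<and> Q ** Q = ?M" for Q
  proof (rule matrix_eq_on_spanning_set[OF expand])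
    fix u assume u: "u \<in> S"
    have "Q *v (Q *v u) = of_real ((cmod (l u))\<^sup>2) *s u"
      using M[OF u] Q by (simp add: matrix_vector_mul_assoc)
    then show "Q *v u = P *v u"
      using psd_square_root_eigenvector[of Q u "cmod (l u)"] Q P(1)[OF u] by simp
  qed
  ultimately have "matrix_abs A = P"
    unfolding matrix_abs_def matrix_sqrt_def by (intro the_equality conjI)
  then show ?thesis using P \<open>u \<in> S\<close> by simp
qed

definition abs_form :: "complex^'n^'n \<Rightarrow> complex^'n \<Rightarrow> real" where
  "abs_form A x = Re (cinner x (matrix_abs A *v x))"

text \<open>In the eigenbasis \<open>\<langle>x, A y\<rangle>\<close> is the sum of \<open>l u \<langle>x, u\<rangle> \<langle>u, y\<rangle>\<close>. With
  \<open>g x u = sqrt |l u| * |\<langle>u, x\<rangle>|\<close> its terms have modulus \<open>g x u * g y u\<close>, while \<open>\<langle>x, |A| x\<rangle>\<close> is the sum of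
  the \<open>(g x u)\<^sup>2\<close>.\<close>

lemma normal_matrix_cauchy_schwarz:
  fixes A :: "complex^'n^'n"
  assumes "normal_matrix A"
  shows abs_form_nonneg: "0 \<le> abs_form A x"
    and cmod_cinner_le_abs_form: "cmod (cinner x (A *v y)) \<le> sqrt (abs_form A x) * sqrt (abs_form A y)"
proof -
  obtain S l where S: "orthonormal S" and eig: "\<And>u. u \<in> S \<Longrightarrow> A *v u = l u *s u"
    and expand: "\<And>x. x = (\<Sum>u\<in>S. cinner u x *s u)"
    using normal_matrix_orthonormal_eigenbasis[OF assms] by metis
  define g where "g x u = sqrt (cmod (l u)) * cmod (cinner u x)" for x u
  have form: "abs_form A x = (\<Sum>u\<in>S. (g x u)\<^sup>2)" for x
    unfolding abs_form_def
    by (subst Re_cinner_eigenbasis[OF matrix_abs_eigenvector[OF assms S eig expand] expand])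
      (auto simp: g_def power_mult_distrib)
  show "0 \<le> abs_form A x" by (simp add: form sum_nonneg)
  have "cmod (cinner x (A *v y)) \<le> (\<Sum>u\<in>S. \<bar>g x u\<bar> * \<bar>g y u\<bar>)"
  proof (subst cinner_eigenbasis[of S A l])
    show "cmod (\<Sum>u\<in>S. l u * (cnj (cinner u x) * cinner u y)) \<le> (\<Sum>u\<in>S. \<bar>g x u\<bar> * \<bar>g y u\<bar>)"
    proof (rule sum_norm_le)
      fix u
      have "cmod (l u * (cnj (cinner u x) * cinner u y))
          = (sqrt (cmod (l u)) * sqrt (cmod (l u))) * (cmod (cinner u x) * cmod (cinner u y))"
        by (simp add: norm_mult)
      also have "\<dots> = g x u * g y u"
        by (simp only: g_def mult_ac)
      finally show "cmod (l u * (cnj (cinner u x) * cinner u y)) \<le> \<bar>g x u\<bar> * \<bar>g y u\<bar>"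
        by (simp add: g_def)
    qed
  qed (fact eig expand)+
  also have "\<dots> \<le> L2_set (g x) S * L2_set (g y) S"
    by (rule L2_set_mult_ineq)
  finally show "cmod (cinner x (A *v y)) \<le> sqrt (abs_form A x) * sqrt (abs_form A y)"
    by (simp add: form L2_set_def)
qed

section \<open>The block matrix\<close>

lemma norm_matrix_vector_le_op_norm: "norm (A *v x) \<le> op_norm A * norm x"
  for A :: "complex^'n^'m"
  unfolding op_norm_def by (rule onorm) (rule matrix_vector_mul_bounded_linear)

lemma abs_form_add_le:
  "abs_form A x + abs_form B x \<le> op_norm (matrix_abs A + matrix_abs B) * (norm x)\<^sup>2"
proof -
  let ?P = "matrix_abs A + matrix_abs B"
  have "abs_form A x + abs_form B x = x \<bullet> (?P *v x)"
    by (simp add: abs_form_def Re_cinner inner_add_right matrix_vector_mult_add_rdistrib)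
  also have "\<dots> \<le> norm x * norm (?P *v x)"
    by (rule norm_cauchy_schwarz)
  also have "\<dots> \<le> norm x * (op_norm ?P * norm x)"
    by (intro mult_left_mono norm_matrix_vector_le_op_norm) auto
  finally show ?thesis by (simp add: power2_eq_square mult_ac)
qed

definition upper :: "'a^('n::finite + 'n) \<Rightarrow> 'a^'n" where "upper x = (\<chi> i. x $ Inl i)"
definition lower :: "'a^('n::finite + 'n) \<Rightarrow> 'a^'n" where "lower x = (\<chi> i. x $ Inr i)"

lemma sum_UNIV_sum_type:
  "(\<Sum>k\<in>(UNIV :: ('n::finite + 'n) set). f k) = (\<Sum>i\<in>UNIV. f (Inl i)) + (\<Sum>i\<in>UNIV. f (Inr i))"
  by (simp flip: UNIV_Plus_UNIV add: sum.Plus)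

lemma cinner_upper_lower: "cinner x y = cinner (upper x) (upper y) + cinner (lower x) (lower y)"
  by (simp add: cinner_def sum_UNIV_sum_type upper_def lower_def)

lemma norm_upper_lower: "(norm (x :: complex^('n::finite + 'n)))\<^sup>2 = (norm (upper x))\<^sup>2 + (norm (lower x))\<^sup>2"
  using cinner_upper_lower[of x x] by (simp add: cinner_self flip: of_real_add of_real_power)

lemma upper_block_matrix: "upper (block_matrix A B C D *v y) = A *v upper y + B *v lower y"
  and lower_block_matrix: "lower (block_matrix A B C D *v y) = C *v upper y + D *v lower y"
  by (simp_all add: vec_eq_iff upper_def lower_def block_matrix_def matrix_vector_mult_def
      sum_UNIV_sum_type)

lemma cauchy_schwarz_four:
  fixes a b c d :: real
  assumes "0 \<le> a" "0 \<le> b" "0 \<le> c" "0 \<le> d" "0 \<le> a'" "0 \<le> b'" "0 \<le> c'" "0 \<le> d'"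
  shows "sqrt a * sqrt a' + sqrt b * sqrt b' + sqrt c * sqrt c' + sqrt d * sqrt d'
    \<le> sqrt (a + b + c + d) * sqrt (a' + b' + c' + d')"
proof -
  define f where "f i = [sqrt a, sqrt b, sqrt c, sqrt d] ! i" for i
  define g where "g i = [sqrt a', sqrt b', sqrt c', sqrt d'] ! i" for i
  have "(\<Sum>i<4. \<bar>f i\<bar> * \<bar>g i\<bar>) \<le> L2_set f {..<4} * L2_set g {..<4}"
    by (rule L2_set_mult_ineq)
  moreover have "{..<4} = {0, 1, 2, 3 :: nat}"
    by auto
  ultimately show ?thesis
    using assms by (simp add: L2_set_def f_def g_def add.assoc)
qed

theorem theorem3p2:
  fixes A B C D :: "complex^'n^'n"
  assumes "normal_matrix A" "normal_matrix B" "normal_matrix C" "normal_matrix D"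
  shows "op_norm (block_matrix A B C D)
    \<le> Max {op_norm (matrix_abs A + matrix_abs B), op_norm (matrix_abs C + matrix_abs D),
            op_norm (matrix_abs A + matrix_abs C), op_norm (matrix_abs B + matrix_abs D)}"
    (is "_ \<le> ?max")
proof -
  define K where "K = ?max"
  let ?M = "block_matrix A B C D"
  have pair: "abs_form X x + abs_form Y x \<le> K * (norm x)\<^sup>2"
    if "op_norm (matrix_abs X + matrix_abs Y) \<le> K" for X Y :: "complex^'n^'n" and x
    using abs_form_add_le[of X x Y] mult_right_mono[OF that, of "(norm x)\<^sup>2"] by simp
  have le_K: "op_norm (matrix_abs A + matrix_abs B) \<le> K" "op_norm (matrix_abs C + matrix_abs D) \<le> K"
    "op_norm (matrix_abs A + matrix_abs C) \<le> K" "op_norm (matrix_abs B + matrix_abs D) \<le> K"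
    by (simp_all add: K_def)
  have "0 \<le> op_norm (matrix_abs A + matrix_abs B)"
    unfolding op_norm_def by (intro onorm_pos_le matrix_vector_mul_bounded_linear)
  then have K: "K \<ge> 0" using le_K(1) by simp
  have bound: "cmod (cinner x (?M *v y)) \<le> K * (norm x * norm y)" for x y
  proof -
    note nn = assms[THEN abs_form_nonneg]
    have triangle: "cmod (a + b + (c + d)) \<le> cmod a + cmod b + cmod c + cmod d" for a b c d
      using norm_triangle_ineq[of "a + b" "c + d"] norm_triangle_ineq[of a b] norm_triangle_ineq[of c d]
      by linarith
    have "cmod (cinner x (?M *v y)) \<le>
        cmod (cinner (upper x) (A *v upper y)) + cmod (cinner (upper x) (B *v lower y))
      + cmod (cinner (lower x) (C *v upper y)) + cmod (cinner (lower x) (D *v lower y))"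
      unfolding cinner_upper_lower[of x] upper_block_matrix lower_block_matrix cinner_add_right
      by (rule triangle)
    also have "\<dots> \<le>
        sqrt (abs_form A (upper x)) * sqrt (abs_form A (upper y))
      + sqrt (abs_form B (upper x)) * sqrt (abs_form B (lower y))
      + sqrt (abs_form C (lower x)) * sqrt (abs_form C (upper y))
      + sqrt (abs_form D (lower x)) * sqrt (abs_form D (lower y))"
      by (intro add_mono cmod_cinner_le_abs_form assms)
    also have "\<dots> \<le>
        sqrt (abs_form A (upper x) + abs_form B (upper x) + abs_form C (lower x) + abs_form D (lower x))
      * sqrt (abs_form A (upper y) + abs_form B (lower y) + abs_form C (upper y) + abs_form D (lower y))"
      by (intro cauchy_schwarz_four nn)
    also have "\<dots> \<le> sqrt (K * (norm x)\<^sup>2) * sqrt (K * (norm y)\<^sup>2)"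
    proof (intro mult_mono real_sqrt_le_mono)
      show "abs_form A (upper x) + abs_form B (upper x) + abs_form C (lower x) + abs_form D (lower x)
          \<le> K * (norm x)\<^sup>2"
        using pair[OF le_K(1), of "upper x"] pair[OF le_K(2), of "lower x"]
        by (simp add: norm_upper_lower[of x] distrib_left)
      show "abs_form A (upper y) + abs_form B (lower y) + abs_form C (upper y) + abs_form D (lower y)
          \<le> K * (norm y)\<^sup>2"
        using pair[OF le_K(3), of "upper y"] pair[OF le_K(4), of "lower y"]
        by (simp add: norm_upper_lower[of y] distrib_left)
    qed (use nn K in auto)
    also have "\<dots> = K * (norm x * norm y)"
      using K by (simp add: real_sqrt_mult)
    finally show ?thesis .
  qed
  show ?thesis
    unfolding op_norm_def[of ?M] K_def[symmetric]
  proof (rule onorm_le)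
    \<comment> \<open>testing the bilinear bound with \<open>x = M y\<close> bounds \<open>norm (M y)\<close> itself\<close>
    fix y
    let ?x = "?M *v y"
    have "(norm ?x)\<^sup>2 \<le> K * (norm ?x * norm y)"
      using bound[of ?x y] by (simp add: cinner_self norm_power)
    then show "norm ?x \<le> K * norm y"
      using K by (cases "norm ?x = 0") (auto simp: power2_eq_square)
  qed
qed

end
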